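(* Let $\beta_1,\beta_2,c$ be real numbers with $c\ne1$, such that none of the hypergeometric denominators below vanishes. Let $b_n,c_n,d_n$ be the recurrence coefficients of the multiple Meixner polynomials of the second kind given in the context, and let $T_m$ be the corresponding tetradiagonal matrices. Put $z=\frac{c}{c-1}$ and for $n\ge0$ set $$a_{6n+1}=\frac{(\beta_1+n)c}{1-c},\qquad a_{6n+4}=\frac{(\beta_2+n)c}{1-c},$$ $$a_{6n+2}=\frac{(n)_n(\beta_2-\beta_1+n)c}{(n+1)_n(1-c)}\cdot\frac{{}_2F_1\left[{-n,\,\beta_2-\beta_1-n\atop -2n+1};z\right]}{{}_2F_1\left[{-n,\,\beta_2-\beta_1-n\atop -2n};z\right]},$$ $$a_{6n+5}=\frac{(n+1)(\beta_1-\beta_2+n+1)c}{(2n+1)(1-c)^2}\cdot\frac{{}_2F_1\left[{-n,\,\beta_2-\beta_1-n\atop -2n};z\right]}{{}_2F_1\left[{-n-1,\,\beta_2-\beta_1-n-1\atop -2n-1};z\right]},$$ $$a_{6n+3}=(2n+1)\frac{{}_2F_1\left[{-n-1,\,\beta_2-\beta_1-n-1\atop -2n-1};z\right]}{{}_2F_1\left[{-n,\,\beta_2-\beta_1-n\atop -2n};z\right]},\qquad a_{6n+6}=\frac{2(n+1)}{1-c}\cdot\frac{{}_2F_1\left[{-n-1,\,\beta_2-\beta_1-n-1\atop -2n-2};z\right]}{{}_2F_1\left[{-n-1,\,\beta_2-\beta_1-n-1\atop -2n-1};z\right]}.$$ Then for every $m\ge1$ one has the bidiagonal factorization $T_m=L_{1,m}L_{2,m}U_m$,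 with $L_{1,m},L_{2,m},U_m$ built from these $a_n$ as in the context. Moreover, if $\beta_1,\beta_2>0$, $0<c<1$ and $-1<\beta_1-\beta_2<0$, then $a_n>0$ for all $n\ge1$.
   Context: Matrices. Given sequences $(b_n)_{n\ge0},(c_n)_{n\ge1},(d_n)_{n\ge2}$, $T_m$ is the $m\times m$ matrix (rows and columns numbered from $1$) with $(T_m)_{i,i}=b_{i-1}$, $(T_m)_{i,i+1}=1$, $(T_m)_{i+1,i}=c_i$, $(T_m)_{i+2,i}=d_{i+1}$ and all other entries $0$. Given $(a_n)_{n\ge1}$: $L_{1,m}$ is the $m\times m$ lower bidiagonal matrix with $1$'s on the diagonal and $(L_{1,m})_{i+1,i}=a_{3i-1}$; $L_{2,m}$ is lower bidiagonal with $1$'s on the diagonal and $(L_{2,m})_{i+1,i}=a_{3i}$; $U_m$ is upper bidiagonal with diagonal entries $(U_m)_{i,i}=a_{3i-2}$ and $1$'s on the superdiagonal. Notation. $(x)_k=x(x+1)\cdots(x+k-1)$, $(x)_0=1$ (in particular $(0)_0=1$). For a nonnegative integer $p$, ${}_2F_1\left[{-p,\,x\atop u};z\right]=\sum_{j=0}^{p}\frac{(-p)_j(x)_j}{(u)_j\,j!}z^j$ (terms $j>p$ are discarded even if $u$ is a nonpositive integer). Recurrence coefficients (multiple Meixner of the second kind), $k\ge0$: $b_{2k}=2k+\frac{c}{1-c}(\beta_1+3k)$; $b_{2k+1}=2k+1+\frac{c}{1-c}(\beta_2+3k+1)$; $c_{2k}=\frac{c}{(1-c)^2}k(\beta_1+\beta_2+3k-2)$;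 $c_{2k+1}=\frac{c}{(1-c)^2}\big((k+1)\beta_1+k(\beta_2+3k+1)\big)$; $d_{2k}=\frac{c^2}{(1-c)^3}k(k+\beta_1-1)(k+\beta_1-\beta_2)$; $d_{2k+1}=\frac{c^2}{(1-c)^3}k(k+\beta_2-1)(k+\beta_2-\beta_1)$. *)

theory Defs
  imports Complex_Main "Jordan_Normal_Form.Matrix"
begin

text \<open>
  Matrices are those of \<open>Jordan_Normal_Form\<close>, whose rows and columns are numbered from 0. The entry
  in row \<open>i\<close> and column \<open>j\<close> of the usual numbering from 1 is therefore the one with indices
  \<open>(i - 1, j - 1)\<close> here. For example \<open>(T)\<^sub>i\<^sub>+\<^sub>1\<^sub>,\<^sub>i = c\<^sub>i\<close> becomes \<open>(T)\<^sub>j\<^sub>+\<^sub>1\<^sub>,\<^sub>j = c\<^sub>j\<^sub>+\<^sub>1\<close>, and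
  \<open>(L\<^sub>1)\<^sub>i\<^sub>+\<^sub>1\<^sub>,\<^sub>i = a\<^sub>3\<^sub>i\<^sub>-\<^sub>1\<close> becomes \<open>(L\<^sub>1)\<^sub>j\<^sub>+\<^sub>1\<^sub>,\<^sub>j = a\<^sub>3\<^sub>j\<^sub>+\<^sub>2\<close>.
\<close>

definition tetradiag_mat ::
  "(nat \<Rightarrow> real) \<Rightarrow> (nat \<Rightarrow> real) \<Rightarrow> (nat \<Rightarrow> real) \<Rightarrow> nat \<Rightarrow> real mat" where
  "tetradiag_mat b c d m = mat m m (\<lambda>(i, j).
     if i = j then b i
     else if j = i + 1 then 1
     else if i = j + 1 then c (j + 1)
     else if i = j + 2 then d (j + 2)
     else 0)"

definition L1_mat :: "(nat \<Rightarrow> real) \<Rightarrow> nat \<Rightarrow> real mat" where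
  "L1_mat a m = mat m m (\<lambda>(i, j).
     if i = j then 1 else if i = j + 1 then a (3 * j + 2) else 0)"

definition L2_mat :: "(nat \<Rightarrow> real) \<Rightarrow> nat \<Rightarrow> real mat" where
  "L2_mat a m = mat m m (\<lambda>(i, j).
     if i = j then 1 else if i = j + 1 then a (3 * j + 3) else 0)"

definition U_mat :: "(nat \<Rightarrow> real) \<Rightarrow> nat \<Rightarrow> real mat" where
  "U_mat a m = mat m m (\<lambda>(i, j).
     if i = j then a (3 * i + 1) else if j = i + 1 then 1 else 0)"

text \<open>
  \<open>hyp2F1 p x u z\<close> is the terminating series with parameters \<open>-p, x; u\<close> and argument \<open>z\<close>,
  truncated at \<open>j = p\<close> even if \<open>u\<close> is a nonpositive integer.
\<close>

definition hyp2F1 :: "nat \<Rightarrow> real \<Rightarrow> real \<Rightarrow> real \<Rightarrow> real" where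
  "hyp2F1 p x u z =
     (\<Sum>j=0..p. pochhammer (- real p) j * pochhammer x j / (pochhammer u j * fact j) * z ^ j)"

definition meixner_b :: "real \<Rightarrow> real \<Rightarrow> real \<Rightarrow> nat \<Rightarrow> real" where
  "meixner_b \<beta>1 \<beta>2 c n = (let k = real (n div 2) in
     if even n then 2 * k + c / (1 - c) * (\<beta>1 + 3 * k)
     else 2 * k + 1 + c / (1 - c) * (\<beta>2 + 3 * k + 1))"

definition meixner_c :: "real \<Rightarrow> real \<Rightarrow> real \<Rightarrow> nat \<Rightarrow> real" where
  "meixner_c \<beta>1 \<beta>2 c n = (let k = real (n div 2) in
     if even n then c / (1 - c)^2 * k * (\<beta>1 + \<beta>2 + 3 * k - 2)
     else c / (1 - c)^2 * ((k + 1) * \<beta>1 + k * (\<beta>2 + 3 * k + 1)))"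

definition meixner_d :: "real \<Rightarrow> real \<Rightarrow> real \<Rightarrow> nat \<Rightarrow> real" where
  "meixner_d \<beta>1 \<beta>2 c n = (let k = real (n div 2) in
     if even n then c^2 / (1 - c)^3 * k * (k + \<beta>1 - 1) * (k + \<beta>1 - \<beta>2)
     else c^2 / (1 - c)^3 * k * (k + \<beta>2 - 1) * (k + \<beta>2 - \<beta>1))"

text \<open>
  The index \<open>N \<ge> 1\<close> is written as \<open>N = 6n + r + 1\<close> with \<open>0 \<le> r \<le> 5\<close>. The value at
  \<open>N = 0\<close> is never used. The lemmas \<open>meixner_a_eqs\<close> give the six cases explicitly.
\<close>

definition meixner_a :: "real \<Rightarrow> real \<Rightarrow> real \<Rightarrow> nat \<Rightarrow> real" where
  "meixner_a \<beta>1 \<beta>2 c N =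
    (let n = (N - 1) div 6; r = (N - 1) mod 6; k = real n; z = c / (c - 1);
         \<delta> = \<beta>2 - \<beta>1 in
     if r = 0 then (\<beta>1 + k) * c / (1 - c)
     else if r = 1 then
       pochhammer k n * (\<delta> + k) * c / (pochhammer (k + 1) n * (1 - c)) *
       (hyp2F1 n (\<delta> - k) (- 2 * k + 1) z / hyp2F1 n (\<delta> - k) (- 2 * k) z)
     else if r = 2 then
       (2 * k + 1) *
       (hyp2F1 (n + 1) (\<delta> - k - 1) (- 2 * k - 1) z / hyp2F1 n (\<delta> - k) (- 2 * k) z)
     else if r = 3 then (\<beta>2 + k) * c / (1 - c)
     else if r = 4 then
       (k + 1) * (\<beta>1 - \<beta>2 + k + 1) * c / ((2 * k + 1) * (1 - c)^2) *
       (hyp2F1 n (\<delta> - k) (- 2 * k) z / hyp2F1 (n + 1) (\<delta> - k - 1) (- 2 * k - 1) z)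
     else
       2 * (k + 1) / (1 - c) *
       (hyp2F1 (n + 1) (\<delta> - k - 1) (- 2 * k - 2) z /
        hyp2F1 (n + 1) (\<delta> - k - 1) (- 2 * k - 1) z))"

lemma meixner_a_eqs:
  fixes \<beta>1 \<beta>2 c :: real and n :: nat
  defines "z \<equiv> c / (c - 1)"
  shows
    "meixner_a \<beta>1 \<beta>2 c (6 * n + 1) = (\<beta>1 + n) * c / (1 - c)"
    "meixner_a \<beta>1 \<beta>2 c (6 * n + 2) =
       pochhammer (real n) n * (\<beta>2 - \<beta>1 + n) * c / (pochhammer (real n + 1) n * (1 - c)) *
       (hyp2F1 n (\<beta>2 - \<beta>1 - n) (- 2 * real n + 1) z / hyp2F1 n (\<beta>2 - \<beta>1 - n) (- 2 * real n) z)"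
    "meixner_a \<beta>1 \<beta>2 c (6 * n + 3) =
       (2 * real n + 1) *
       (hyp2F1 (n + 1) (\<beta>2 - \<beta>1 - n - 1) (- 2 * real n - 1) z /
        hyp2F1 n (\<beta>2 - \<beta>1 - n) (- 2 * real n) z)"
    "meixner_a \<beta>1 \<beta>2 c (6 * n + 4) = (\<beta>2 + n) * c / (1 - c)"
    "meixner_a \<beta>1 \<beta>2 c (6 * n + 5) =
       (real n + 1) * (\<beta>1 - \<beta>2 + n + 1) * c / ((2 * real n + 1) * (1 - c)^2) *
       (hyp2F1 n (\<beta>2 - \<beta>1 - n) (- 2 * real n) z /
        hyp2F1 (n + 1) (\<beta>2 - \<beta>1 - n - 1) (- 2 * real n - 1) z)"
    "meixner_a \<beta>1 \<beta>2 c (6 * n + 6) =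
       2 * (real n + 1) / (1 - c) *
       (hyp2F1 (n + 1) (\<beta>2 - \<beta>1 - n - 1) (- 2 * real n - 2) z /
        hyp2F1 (n + 1) (\<beta>2 - \<beta>1 - n - 1) (- 2 * real n - 1) z)"
proof -
  have idx: "(6 * n + Suc r - 1) div 6 = n" "(6 * n + Suc r - 1) mod 6 = r" if "r < 6" for r
    using that by auto
  note unf = meixner_a_def Let_def z_def
  show "meixner_a \<beta>1 \<beta>2 c (6 * n + 1) = (\<beta>1 + n) * c / (1 - c)"
    using idx[of 0] by (simp add: unf)
  show "meixner_a \<beta>1 \<beta>2 c (6 * n + 2) =
       pochhammer (real n) n * (\<beta>2 - \<beta>1 + n) * c / (pochhammer (real n + 1) n * (1 - c)) *
       (hyp2F1 n (\<beta>2 - \<beta>1 - n) (- 2 * real n + 1) z / hyp2F1 n (\<beta>2 - \<beta>1 - n) (- 2 * real n) z)"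
    using idx[of 1] by (simp add: unf)
  show "meixner_a \<beta>1 \<beta>2 c (6 * n + 3) =
       (2 * real n + 1) *
       (hyp2F1 (n + 1) (\<beta>2 - \<beta>1 - n - 1) (- 2 * real n - 1) z /
        hyp2F1 n (\<beta>2 - \<beta>1 - n) (- 2 * real n) z)"
    using idx[of 2] by (simp add: unf)
  show "meixner_a \<beta>1 \<beta>2 c (6 * n + 4) = (\<beta>2 + n) * c / (1 - c)"
    using idx[of 3] by (simp add: unf)
  show "meixner_a \<beta>1 \<beta>2 c (6 * n + 5) =
       (real n + 1) * (\<beta>1 - \<beta>2 + n + 1) * c / ((2 * real n + 1) * (1 - c)^2) *
       (hyp2F1 n (\<beta>2 - \<beta>1 - n) (- 2 * real n) z /
        hyp2F1 (n + 1) (\<beta>2 - \<beta>1 - n - 1) (- 2 * real n - 1) z)"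
    using idx[of 4] by (simp add: unf)
  show "meixner_a \<beta>1 \<beta>2 c (6 * n + 6) =
       2 * (real n + 1) / (1 - c) *
       (hyp2F1 (n + 1) (\<beta>2 - \<beta>1 - n - 1) (- 2 * real n - 2) z /
        hyp2F1 (n + 1) (\<beta>2 - \<beta>1 - n - 1) (- 2 * real n - 1) z)"
    using idx[of 5] by (simp add: unf)
qed

end

theory Submission
  imports Defs
begin

text \<open>
  Only the series \<open>A\<^sub>n = F(-n, \<delta> - n; -2n; z)\<close> and \<open>B\<^sub>n = F(-n-1, \<delta> - n - 1; -2n - 1; z)\<close>, where
  \<open>\<delta> = \<beta>2 - \<beta>1\<close>, occur in the \<open>a\<^sub>n\<close> (for \<open>n \<ge> 1\<close> the numerator of \<open>a\<^sub>6\<^sub>n\<^sub>+\<^sub>2\<close> is \<open>B\<^sub>n\<^sub>-\<^sub>1\<close>), and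
  two contiguous relations connect them: one between \<open>B\<^sub>n\<close>, \<open>A\<^sub>n\<^sub>+\<^sub>1\<close>, \<open>A\<^sub>n\<close>, the other between
  \<open>A\<^sub>n\<close>, \<open>B\<^sub>n\<close>, \<open>B\<^sub>n\<^sub>-\<^sub>1\<close>. Comparing entries in \<open>T = L\<^sub>1 L\<^sub>2 U\<close>, the equations for \<open>b\<close> are these two
  relations. They evaluate the sums \<open>a\<^sub>3\<^sub>i\<^sub>+\<^sub>2 + a\<^sub>3\<^sub>i\<^sub>+\<^sub>3\<close>, after which the equations for \<open>c\<close> and \<open>d\<close>
  are polynomial identities, because the products \<open>a\<^sub>3\<^sub>i\<^sub>+\<^sub>2 a\<^sub>3\<^sub>i\<close> are free of hypergeometric
  factors. In the positivity range every term of each series is positive.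
\<close>

section \<open>The entries of the bidiagonal product\<close>

lemma sum_lower_bidiag_row:
  fixes f g :: "nat \<Rightarrow> 'a :: semiring_1"
  assumes "i < m"
  shows "(\<Sum>k = 0..<m. (if i = k then 1 else if i = k + 1 then g k else 0) * f k) =
         f i + (if i = 0 then 0 else g (i - 1) * f (i - 1))"
proof (cases i)
  case 0
  have "(\<Sum>k = 0..<m. (if i = k then 1 else if i = k + 1 then g k else 0) * f k) =
        (\<Sum>k = 0..<m. if i = k then f k else 0)"
    using 0 by (intro sum.cong) auto
  then show ?thesis
    using 0 assms by simp
next
  case (Suc l)
  have "(\<Sum>k = 0..<m. (if i = k then 1 else if i = k + 1 then g k else 0) * f k) =
        (\<Sum>k = 0..<m. (if i = k then f k else 0) + (if l = k then g k * f k else 0))"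
    using Suc by (intro sum.cong) auto
  then show ?thesis
    using Suc assms by (simp add: sum.distrib)
qed

text \<open>A unit lower bidiagonal factor on the left adds to each row a multiple of the row above.
  Both \<open>L1_mat\<close> and \<open>L2_mat\<close> have this form, so the triple product is
  peeled one factor at a time.\<close>

lemma lower_bidiag_mult_index:
  fixes M :: "'a :: semiring_1 mat"
  assumes "M \<in> carrier_mat m n" "i < m" "j < n"
  shows "(mat m m (\<lambda>(i, j). if i = j then 1 else if i = j + 1 then g j else 0) * M) $$ (i, j) =
         M $$ (i, j) + (if i = 0 then 0 else g (i - 1) * M $$ (i - 1, j))"
  using assms sum_lower_bidiag_row[of i m g "\<lambda>k. M $$ (k, j)"]
  by (simp add: scalar_prod_def)

text \<open>The superdiagonal of the product is 1 automatically, so equations remain only for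
  \<open>b\<close>, \<open>c\<close> and \<open>d\<close>. They do not involve \<open>m\<close>,
  since entry \<open>(i, j)\<close> uses only rows of \<open>U_mat\<close> with index at most
  \<open>i\<close>. The values \<open>b 0\<close> and \<open>c 1\<close> stand apart because rows 0
  and 1 have fewer rows above them.\<close>

lemma tetradiag_mat_factorization:
  assumes b0: "b 0 = a 1"
    and b: "\<And>i. b (i + 1) = a (3 * i + 4) + a (3 * i + 3) + a (3 * i + 2)"
    and c1: "c 1 = (a 2 + a 3) * a 1"
    and c: "\<And>i. c (i + 2) =
      (a (3 * i + 5) + a (3 * i + 6)) * a (3 * i + 4) + a (3 * i + 5) * a (3 * i + 3)"
    and d: "\<And>i. d (i + 2) = a (3 * i + 5) * a (3 * i + 3) * a (3 * i + 1)"
  shows "tetradiag_mat b c d m = L1_mat a m * L2_mat a m * U_mat a m"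
proof -
  have carrier: "L1_mat a m \<in> carrier_mat m m" "L2_mat a m \<in> carrier_mat m m"
      "U_mat a m \<in> carrier_mat m m"
    by (auto simp: L1_mat_def L2_mat_def U_mat_def)
  have L2U: "(L2_mat a m * U_mat a m) $$ (i, j) =
      U_mat a m $$ (i, j) + (if i = 0 then 0 else a (3 * (i - 1) + 3) * U_mat a m $$ (i - 1, j))"
    if "i < m" "j < m" for i j
    unfolding L2_mat_def
    by (rule lower_bidiag_mult_index) (use that carrier in auto)
  have L1L2U: "(L1_mat a m * (L2_mat a m * U_mat a m)) $$ (i, j) =
      (L2_mat a m * U_mat a m) $$ (i, j) +
      (if i = 0 then 0 else a (3 * (i - 1) + 2) * (L2_mat a m * U_mat a m) $$ (i - 1, j))"
    if "i < m" "j < m" for i j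
    unfolding L1_mat_def
    by (rule lower_bidiag_mult_index) (use that carrier in auto)
  have U: "U_mat a m $$ (i, j) = (if i = j then a (3 * i + 1) else if j = i + 1 then 1 else 0)"
    if "i < m" "j < m" for i j
    using that by (simp add: U_mat_def)
  have T: "tetradiag_mat b c d m $$ (i, j) =
      (if i = j then b i else if j = i + 1 then 1 else if i = j + 1 then c (j + 1)
       else if i = j + 2 then d (j + 2) else 0)" if "i < m" "j < m" for i j
    using that by (simp add: tetradiag_mat_def)
  have c': "c (Suc (Suc i)) =
      (a (3 * i + 5) + a (3 * i + 6)) * a (3 * i + 4) + a (3 * i + 5) * a (3 * i + 3)" for i
    using c[of i] by simp
  have d': "d (Suc (Suc i)) = a (3 * i + 5) * a (3 * i + 3) * a (3 * i + 1)" for i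
    using d[of i] by simp
  have b': "b (Suc i) = a (3 * i + 4) + a (3 * i + 3) + a (3 * i + 2)" for i
    using b[of i] by simp
  have c1': "c (Suc 0) = (a 2 + a 3) * a 1"
    using c1 by simp
  have "tetradiag_mat b c d m = L1_mat a m * (L2_mat a m * U_mat a m)"
  proof (rule eq_matI)
    fix i j
    assume "i < dim_row (L1_mat a m * (L2_mat a m * U_mat a m))"
      and "j < dim_col (L1_mat a m * (L2_mat a m * U_mat a m))"
    then have ij: "i < m" "j < m"
      using carrier by auto
    \<comment> \<open>Row \<open>i\<close> of the product combines rows \<open>i\<close>,
      \<open>i - 1\<close> and \<open>i - 2\<close> of \<open>U_mat\<close>; only from
      \<open>i = 2\<close> on do all three exist.\<close>
    consider "i = 0" | "i = 1" | k where "i = Suc (Suc k)"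
      by (metis One_nat_def not0_implies_Suc)
    then show "tetradiag_mat b c d m $$ (i, j) =
        (L1_mat a m * (L2_mat a m * U_mat a m)) $$ (i, j)"
    proof cases
      case 1
      then show ?thesis
        using ij b0 by (simp add: L1L2U L2U U T)
    next
      case 2
      then show ?thesis
        using ij b'[of 0] c1' by (auto simp: L1L2U L2U U T eval_nat_numeral algebra_simps)
    next
      case (3 k)
      have num: "3 * Suc k + 1 = 3 * k + 4" "3 * Suc k + 2 = 3 * k + 5" "3 * Suc k + 3 = 3 * k + 6"
        "3 * Suc (Suc k) + 1 = 3 * k + 7"
        by simp_all
      have "k < m" "Suc k < m" "Suc (Suc k) < m"
        using ij 3 by auto
      then show ?thesis
        unfolding 3 using ij b'[of "Suc k"] c'[of k] d'[of k]
        by (auto simp: L1L2U L2U U T num algebra_simps)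
    qed
  qed (use carrier in \<open>auto simp: tetradiag_mat_def\<close>)
  then show ?thesis
    using carrier by simp
qed

section \<open>Contiguous relations for terminating series\<close>

lemma hyp2F1_atMost:
  "hyp2F1 p x u z =
     (\<Sum>j\<le>p. pochhammer (- real p) j * pochhammer x j / (pochhammer u j * fact j) * z ^ j)"
  by (simp add: hyp2F1_def atMost_atLeast0)

lemma hyp2F1_0 [simp]: "hyp2F1 0 x u z = 1"
  by (simp add: hyp2F1_def)

text \<open>Splitting off the constant term leaves powers \<open>z ^ Suc j\<close> with
  \<open>j \<le> p\<close>, to be matched term by term with the sum in
  \<open>mult_hyp2F1\<close>.\<close>

lemma hyp2F1_Suc_shift:
  "hyp2F1 (Suc p) x u z = 1 + (\<Sum>j\<le>p.
     pochhammer (- real (Suc p)) (Suc j) * pochhammer x (Suc j) /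
     (pochhammer u (Suc j) * fact (Suc j)) * z ^ Suc j)"
  unfolding hyp2F1_atMost by (subst sum.atMost_Suc_shift) simp

text \<open>The range is extended by the term of index \<open>Suc p\<close>, which is 0 because its
  factor \<open>pochhammer (- real p) (Suc p)\<close> vanishes, whatever its denominator is.\<close>

lemma hyp2F1_shift:
  "hyp2F1 p x u z = 1 + (\<Sum>j\<le>p.
     pochhammer (- real p) (Suc j) * pochhammer x (Suc j) /
     (pochhammer u (Suc j) * fact (Suc j)) * z ^ Suc j)"
proof -
  have "pochhammer (- real p) (Suc p) = 0"
    by (simp add: pochhammer_Suc)
  then have "hyp2F1 p x u z = (\<Sum>j\<le>Suc p.
      pochhammer (- real p) j * pochhammer x j / (pochhammer u j * fact j) * z ^ j)"
    unfolding hyp2F1_atMost by simp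
  then show ?thesis
    by (subst (asm) sum.atMost_Suc_shift) simp
qed

lemma mult_hyp2F1:
  "r * z * hyp2F1 p x u z = (\<Sum>j\<le>p.
     r * (pochhammer (- real p) j * pochhammer x j / (pochhammer u j * fact j)) * z ^ Suc j)"
  unfolding hyp2F1_atMost by (simp add: sum_distrib_left mult_ac)

lemma pochhammer_add_1:
  fixes u :: "'a :: comm_semiring_1"
  shows "u * pochhammer (u + 1) j = pochhammer u j * (u + of_nat j)"
  by (metis pochhammer_rec pochhammer_Suc)

lemma pochhammer_neq_0_le:
  fixes u :: "'a :: field_char_0"
  assumes "\<And>i. i < p \<Longrightarrow> u + of_nat i \<noteq> 0" "j \<le> p"
  shows "pochhammer u j \<noteq> 0"
proof -
  have "u \<noteq> - of_nat i" if "i < j" for i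
    using assms(1)[of i] assms(2) that by (metis add.left_inverse order_less_le_trans)
  then show ?thesis
    by (auto simp: pochhammer_eq_0_iff)
qed

text \<open>With \<open>R = pochhammer (u + 2) j\<close>, the reciprocals of
  \<open>pochhammer (u + 1) (Suc j)\<close> and \<open>pochhammer u (Suc j)\<close> differ by
  \<open>- (j + 1) / (u * (u + 1) * R)\<close>. The factor \<open>j + 1\<close> turns
  \<open>fact (Suc j)\<close> into \<open>fact j\<close>, which gives the coefficient of the last
  series.\<close>

lemma hyp2F1_contiguous_lower:
  assumes u: "\<And>i. i \<le> Suc p \<Longrightarrow> u + real i \<noteq> 0"
  shows "hyp2F1 (Suc p) x (u + 1) z = hyp2F1 (Suc p) x u z +
         (real p + 1) * x / (u * (u + 1)) * z * hyp2F1 p (x + 1) (u + 2) z"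
proof -
  have "pochhammer (- real (Suc p)) (Suc j) * pochhammer x (Suc j) /
          (pochhammer (u + 1) (Suc j) * fact (Suc j)) =
        pochhammer (- real (Suc p)) (Suc j) * pochhammer x (Suc j) /
          (pochhammer u (Suc j) * fact (Suc j)) +
        (real p + 1) * x / (u * (u + 1)) *
          (pochhammer (- real p) j * pochhammer (x + 1) j / (pochhammer (u + 2) j * fact j))"
    if "j \<le> p" for j
  proof -
    define R where "R = pochhammer (u + 2) j"
    define P where "P = pochhammer (- real p) j"
    define Q where "Q = pochhammer (x + 1) j"
    have u0: "u \<noteq> 0" "u + 1 \<noteq> 0" "u + 1 + real j \<noteq> 0"
      using u[of 0] u[of 1] u[of "Suc j"] that by (auto simp: add_ac)
    have R': "u * (u + 1) * R = pochhammer u (Suc j) * (u + 1 + real j)"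
      unfolding R_def
      using pochhammer_rec[of u "Suc j"] pochhammer_rec[of "u + 1" j] pochhammer_Suc[of u "Suc j"]
      by (simp add: algebra_simps)
    have R0: "R \<noteq> 0"
    proof -
      have "pochhammer u (Suc j) \<noteq> 0"
        by (rule pochhammer_neq_0_le[of "Suc (Suc p)"]) (use u that in auto)
      then show ?thesis
        using R' u0 by auto
    qed
    have "pochhammer u (Suc j) = u * (u + 1) * R / (u + 1 + real j)"
      using R' u0 by (simp add: field_simps)
    moreover have "pochhammer (u + 1) (Suc j) = (u + 1) * R"
      unfolding R_def using pochhammer_rec[of "u + 1" j] by (simp add: add_ac)
    moreover have "pochhammer (- real (Suc p)) (Suc j) = - (real p + 1) * P"
      unfolding P_def by (subst pochhammer_rec) (simp add: algebra_simps)
    moreover have "pochhammer x (Suc j) = x * Q"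
      unfolding Q_def by (rule pochhammer_rec)
    moreover have "- (real p + 1) * P * (x * Q) / ((u + 1) * R * fact (Suc j)) =
        - (real p + 1) * P * (x * Q) / (u * (u + 1) * R / (u + 1 + real j) * fact (Suc j)) +
        (real p + 1) * x / (u * (u + 1)) * (P * Q / (R * fact j))"
      using u0 R0 by (simp add: divide_simps) (simp add: algebra_simps)
    ultimately show ?thesis
      unfolding P_def Q_def R_def by simp
  qed
  then show ?thesis
    unfolding mult_hyp2F1 hyp2F1_Suc_shift add.assoc sum.distrib[symmetric]
    by (intro arg_cong2[of _ _ _ _ "(+)"] sum.cong refl) (simp add: algebra_simps)
qed

text \<open>At \<open>z ^ Suc j\<close> the left side contributes coefficient \<open>Suc j\<close>
  minus coefficient \<open>j\<close> of one series. Once all Pochhammer symbols are expressed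
  through those of index \<open>j\<close>, a rational identity in \<open>u\<close>,
  \<open>x\<close>, \<open>p\<close>, \<open>j\<close> remains.\<close>

lemma hyp2F1_contiguous_diagonal:
  assumes u1: "u \<noteq> 1" and u: "\<And>i. i \<le> p \<Longrightarrow> u + real i \<noteq> 0"
  shows "(1 - z) * hyp2F1 p x u z = hyp2F1 (Suc p) (x - 1) (u - 1) z -
         (u + real p) * (u - x) / (u * (u - 1)) * z * hyp2F1 p x (u + 1) z"
proof -
  \<comment> \<open>The explicit factor \<open>1\<close> plays the part of \<open>r\<close> in
    \<open>mult_hyp2F1\<close>, so that the rewritten sums match this identity literally.\<close>
  have coeff: "pochhammer (- real p) (Suc j) * pochhammer x (Suc j) /
          (pochhammer u (Suc j) * fact (Suc j)) -
        1 * (pochhammer (- real p) j * pochhammer x j / (pochhammer u j * fact j)) =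
        pochhammer (- real (Suc p)) (Suc j) * pochhammer (x - 1) (Suc j) /
          (pochhammer (u - 1) (Suc j) * fact (Suc j)) -
        (u + real p) * (u - x) / (u * (u - 1)) *
          (pochhammer (- real p) j * pochhammer x j / (pochhammer (u + 1) j * fact j))"
    if "j \<le> p" for j
  proof -
    define R where "R = pochhammer u j"
    define P where "P = pochhammer (- real p) j"
    define Q where "Q = pochhammer x j"
    have u0: "u \<noteq> 0" "u - 1 \<noteq> 0" "u + real j \<noteq> 0"
      using u[of 0] u1 u[of j] that by auto
    have R0: "R \<noteq> 0"
      unfolding R_def by (rule pochhammer_neq_0_le[of "Suc p"]) (use u that in auto)
    have "pochhammer (u + 1) j = R * (u + real j) / u"
      unfolding R_def using pochhammer_add_1[of u j] u0 by (simp add: field_simps)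
    moreover have "pochhammer (u - 1) (Suc j) = (u - 1) * R"
      unfolding R_def by (subst pochhammer_rec) simp
    moreover have "pochhammer (- real (Suc p)) (Suc j) = - (real p + 1) * P"
      unfolding P_def by (subst pochhammer_rec) (simp add: algebra_simps)
    moreover have "pochhammer (x - 1) (Suc j) = (x - 1) * Q"
      unfolding Q_def by (subst pochhammer_rec) simp
    moreover have "P * (- real p + real j) * (Q * (x + real j)) / (R * (u + real j) * fact (Suc j)) -
          1 * (P * Q / (R * fact j)) =
        - (real p + 1) * P * ((x - 1) * Q) / ((u - 1) * R * fact (Suc j)) -
        (u + real p) * (u - x) / (u * (u - 1)) * (P * Q / (R * (u + real j) / u * fact j))"
      using u0 R0 by (simp add: divide_simps) (simp add: algebra_simps)
    ultimately show ?thesis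
      unfolding P_def Q_def R_def pochhammer_Suc by simp
  qed
  have "hyp2F1 p x u z - 1 * z * hyp2F1 p x u z =
      hyp2F1 (Suc p) (x - 1) (u - 1) z -
      (u + real p) * (u - x) / (u * (u - 1)) * z * hyp2F1 p x (u + 1) z"
    unfolding mult_hyp2F1
    unfolding hyp2F1_Suc_shift hyp2F1_shift[of p x u] add_diff_eq[symmetric] sum_subtractf[symmetric]
    by (intro arg_cong2[of _ _ _ _ "(+)"] sum.cong refl)
      (simp only: left_diff_distrib[symmetric] coeff atMost_iff)
  then show ?thesis
    by (simp add: algebra_simps)
qed

lemma signed_pochhammer_pos:
  fixes x :: "'a :: linordered_idom"
  assumes "x < 1 - of_nat j"
  shows "0 < (- 1) ^ j * pochhammer x j"
  using assms
proof (induction j)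
  case (Suc j)
  then have "x < - of_nat j" "0 < (- 1) ^ j * pochhammer x j"
    by simp_all
  then have "0 < ((- 1) ^ j * pochhammer x j) * - (x + of_nat j)"
    by (intro mult_pos_pos[of "(- 1) ^ j * pochhammer x j"]) simp_all
  then show ?case
    by (simp add: pochhammer_Suc algebra_simps)
qed simp

text \<open>For \<open>j \<le> p\<close> the three Pochhammer symbols and \<open>z ^ j\<close> each
  have sign \<open>(- 1) ^ j\<close>; the four signs cancel, so every term is positive.\<close>

lemma hyp2F1_pos:
  assumes "x < 1 - real p" "u < 1 - real p" "z < 0"
  shows "0 < hyp2F1 p x u z"
  unfolding hyp2F1_atMost
proof (rule sum_pos)
  fix j assume "j \<in> {..p}"
  then have j: "real j \<le> real p"
    by simp
  define s :: real where "s = (- 1) ^ j"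
  have s: "s * s = 1"
    by (simp add: s_def power_mult_distrib[symmetric])
  have "0 < (s * pochhammer (- real p) j) * (s * pochhammer x j) /
            ((s * pochhammer u j) * fact j) * (- z) ^ j"
    unfolding s_def using assms j
    by (intro mult_pos_pos divide_pos_pos signed_pochhammer_pos zero_less_power fact_gt_zero) auto
  also have "(- z) ^ j = s * z ^ j"
    unfolding s_def by (rule power_minus)
  also have "(s * pochhammer (- real p) j) * (s * pochhammer x j) /
      ((s * pochhammer u j) * fact j) * (s * z ^ j) =
      (s * s) * (pochhammer (- real p) j * pochhammer x j / (pochhammer u j * fact j) * z ^ j)"
    by (simp add: s_def)
  finally show "0 < pochhammer (- real p) j * pochhammer x j / (pochhammer u j * fact j) * z ^ j"
    unfolding s by simp
qed auto

section \<open>The factorization\<close>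

theorem proposition3p4:
  fixes \<beta>1 \<beta>2 c :: real
  assumes c_neq_1: "c \<noteq> 1"
    and denom1: "\<And>n::nat. hyp2F1 n (\<beta>2 - \<beta>1 - real n) (- 2 * real n) (c / (c - 1)) \<noteq> 0"
    and denom2: "\<And>n::nat. hyp2F1 (n + 1) (\<beta>2 - \<beta>1 - real n - 1) (- 2 * real n - 1) (c / (c - 1)) \<noteq> 0"
  shows "(\<forall>m\<ge>1. tetradiag_mat (meixner_b \<beta>1 \<beta>2 c) (meixner_c \<beta>1 \<beta>2 c) (meixner_d \<beta>1 \<beta>2 c) m =
                 L1_mat (meixner_a \<beta>1 \<beta>2 c) m * L2_mat (meixner_a \<beta>1 \<beta>2 c) m * U_mat (meixner_a \<beta>1 \<beta>2 c) m)
       \<and> (\<beta>1 > 0 \<and> \<beta>2 > 0 \<and> 0 < c \<and> c < 1 \<and> - 1 < \<beta>1 - \<beta>2 \<and> \<beta>1 - \<beta>2 < 0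
           \<longrightarrow> (\<forall>n\<ge>1. meixner_a \<beta>1 \<beta>2 c n > 0))"
proof -
  \<comment> \<open>Since \<open>w = -z\<close> and \<open>1 / (1 - c) = 1 + w\<close>, the
    recurrence coefficients become polynomials in \<open>w\<close> and no division by
    \<open>1 - c\<close> remains in them.\<close>
  define \<delta> w where "\<delta> = \<beta>2 - \<beta>1" and "w = c / (1 - c)"
  define A where "A n = hyp2F1 n (\<delta> - real n) (- 2 * real n) (- w)" for n
  define B where "B n = hyp2F1 (Suc n) (\<delta> - real n - 1) (- 2 * real n - 1) (- w)" for n
  have c1: "1 - c \<noteq> 0"
    using c_neq_1 by simp
  have z: "c / (c - 1) = - w"
    by (metis minus_diff_eq minus_divide_right w_def)
  have w1: "1 / (1 - c) = 1 + w"
    using c1 by (simp add: w_def divide_simps)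
  have cw: "c / (1 - c)^2 = w * (1 + w)" and cw': "c^2 / (1 - c)^3 = w^2 * (1 + w)"
    unfolding w1[symmetric] by (simp_all add: w_def power2_eq_square power3_eq_cube)
  have A_neq_0: "A n \<noteq> 0" and B_neq_0: "B n \<noteq> 0" for n
    using denom1[of n] denom2[of n] by (simp_all add: A_def B_def \<delta>_def z)
  have A_0: "A 0 = 1"
    by (simp add: A_def)
  have B_0: "B 0 = 1 + w - \<delta> * w"
    by (simp add: B_def hyp2F1_def algebra_simps)
  have A_Suc: "hyp2F1 (Suc n) (\<delta> - real n - 1) (- 2 * real n - 2) (- w) = A (Suc n)" for n
  proof -
    have "\<delta> - real n - 1 = \<delta> - real (Suc n)" "- 2 * real n - 2 = - 2 * real (Suc n)"
      by simp_all
    then show ?thesis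
      by (simp only: A_def)
  qed
  have B_shift: "hyp2F1 (Suc n) (\<delta> - real (Suc n)) (- 2 * real (Suc n) + 1) (- w) = B n" for n
  proof -
    have "\<delta> - real (Suc n) = \<delta> - real n - 1" "- 2 * real (Suc n) + 1 = - 2 * real n - 1"
      by simp_all
    then show ?thesis
      by (simp only: B_def)
  qed

  \<comment> \<open>The two contiguous relations between \<open>A\<close> and
    \<open>B\<close>\<close>
  have rel1: "B n = A (Suc n) + (real n + 1 - \<delta>) * w / (2 * (2 * real n + 1)) * A n" for n
  proof -
    have nz: "- 2 * real n - 2 + real i \<noteq> 0" if "i \<le> Suc n" for i
      using that by linarith
    have args: "- 2 * real n - 2 + 1 = - 2 * real n - 1" "- 2 * real n - 2 + 2 = - 2 * real n"
        "\<delta> - real n - 1 + 1 = \<delta> - real n"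
      by simp_all
    \<comment> \<open>With lower parameter \<open>-2n - 2\<close> and
      \<open>x = \<delta> - n - 1\<close>, the three series of
      \<open>hyp2F1_contiguous_lower\<close> are \<open>B n\<close>, \<open>A (Suc n)\<close> and
      \<open>A n\<close>.\<close>
    have "B n = A (Suc n) + (real n + 1) * (\<delta> - real n - 1) /
        ((- 2 * real n - 2) * (- 2 * real n - 1)) * - w * A n"
      using hyp2F1_contiguous_lower[of n "- 2 * real n - 2" "\<delta> - real n - 1" "- w", OF nz]
      unfolding args A_Suc by (simp only: A_def B_def)
    also have "(real n + 1) * (\<delta> - real n - 1) / ((- 2 * real n - 2) * (- 2 * real n - 1)) * - w =
        (real n + 1 - \<delta>) * w / (2 * (2 * real n + 1))"
    proof -
      define N M where "N = real n + 1" and "M = 2 * real n + 1"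
      have "N > 0" "M > 0"
        by (simp_all add: N_def M_def)
      moreover have "- 2 * real n - 2 = - 2 * N" "- 2 * real n - 1 = - M"
          "\<delta> - real n - 1 = \<delta> - N"
        by (simp_all add: N_def M_def)
      moreover have "N * (\<delta> - N) / (- 2 * N * - M) * - w = (N - \<delta>) * w / (2 * M)"
        using \<open>N > 0\<close> \<open>M > 0\<close> by (simp add: divide_simps) (simp add: algebra_simps)
      ultimately show ?thesis
        by (simp only: N_def[symmetric] M_def[symmetric])
    qed
    finally show ?thesis .
  qed
  \<comment> \<open>This is \<open>hyp2F1_contiguous_diagonal\<close> with \<open>p = N\<close>,
    \<open>u = -2N\<close>, \<open>x = \<delta> - N\<close> for \<open>N = n + 1\<close>, where
    \<open>1 - z = 1 + w\<close>. The index starts at 1 because \<open>u\<close> would be 0 for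
    \<open>N = 0\<close>; that case is computed directly in \<open>a2_a3\<close>.\<close>
  have rel2: "(2 * real n + 3) * ((1 + w) * A (Suc n)) =
      (2 * real n + 3) * B (Suc n) + (\<delta> + real n + 1) * w / 2 * B n" for n
  proof -
    define N where "N = real (Suc n)"
    have "N > 0"
      by (simp add: N_def)
    then have N: "N \<noteq> 0" "2 * N + 1 \<noteq> 0"
      by linarith+
    have nz: "- 2 * N + real i \<noteq> 0" if "i \<le> Suc n" for i
    proof -
      have "real i \<le> N"
        using that unfolding N_def by (simp only: of_nat_le_iff)
      then show ?thesis
        using \<open>N > 0\<close> by linarith
    qed
    have neq: "- 2 * N \<noteq> 1"
      using N(2) by linarith
    have args: "- 2 * N + N = - N" "- 2 * N - (\<delta> - N) = - N - \<delta>"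
      by simp_all
    have "(1 + w) * A (Suc n) = B (Suc n) -
        (- N) * (- N - \<delta>) / ((- 2 * N) * (- 2 * N - 1)) * - w * B n"
      using hyp2F1_contiguous_diagonal[of "- 2 * N" "Suc n" "- w" "\<delta> - N", OF neq nz]
        B_shift[of n] A_def[of "Suc n"] B_def[of "Suc n"]
      by (simp only: args N_def[symmetric] minus_minus diff_minus_eq_add)
    moreover have "(- N) * (- N - \<delta>) / ((- 2 * N) * (- 2 * N - 1)) =
        (\<delta> + N) / (2 * (2 * N + 1))"
      using N by (simp add: divide_simps) (simp add: algebra_simps)
    ultimately have "(1 + w) * A (Suc n) = B (Suc n) + (\<delta> + N) / (2 * (2 * N + 1)) * w * B n"
      by simp
    then have "(2 * N + 1) * ((1 + w) * A (Suc n)) =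
        (2 * N + 1) * B (Suc n) + (\<delta> + N) * w / 2 * B n"
      using N(2) by (simp add: field_simps)
    then show ?thesis
      by (simp add: N_def algebra_simps)
  qed

  \<comment> \<open>The factorization coefficients in terms of \<open>A\<close>, \<open>B\<close>
    and \<open>w\<close>\<close>
  have a1: "meixner_a \<beta>1 \<beta>2 c (6 * n + 1) = (\<beta>1 + n) * w"
    and a3: "meixner_a \<beta>1 \<beta>2 c (6 * n + 3) = (2 * real n + 1) * (B n / A n)"
    and a4: "meixner_a \<beta>1 \<beta>2 c (6 * n + 4) = (\<beta>2 + n) * w" for n
    unfolding meixner_a_eqs z by (simp_all add: A_def B_def \<delta>_def w_def)
  have a5: "meixner_a \<beta>1 \<beta>2 c (6 * n + 5) =
      (real n + 1) * (real n + 1 - \<delta>) * w * (1 + w) / (2 * real n + 1) * (A n / B n)" for n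
  proof -
    have "meixner_a \<beta>1 \<beta>2 c (6 * n + 5) =
        (real n + 1) * (real n + 1 - \<delta>) * c / ((2 * real n + 1) * (1 - c)^2) * (A n / B n)"
      unfolding meixner_a_eqs z by (simp add: A_def B_def \<delta>_def algebra_simps)
    moreover have "c / ((2 * real n + 1) * (1 - c)^2) = w * (1 + w) / (2 * real n + 1)"
      unfolding cw[symmetric] by (simp add: mult.commute)
    ultimately show ?thesis
      by (metis times_divide_eq_right mult.assoc)
  qed
  have a6: "meixner_a \<beta>1 \<beta>2 c (6 * n + 6) = 2 * (real n + 1) * (1 + w) * (A (Suc n) / B n)" for n
    unfolding meixner_a_eqs z using A_Suc[of n] by (simp add: \<delta>_def B_def flip: w1)
  \<comment> \<open>For \<open>n = 0\<close> the convention \<open>(0)_0 = 1\<close> makes the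
    Pochhammer quotient 1, whereas for \<open>n \<ge> 1\<close> it is 1/2. Hence index 2 is kept
    apart from the indices \<open>6 * n + 8\<close>.\<close>
  have a2: "meixner_a \<beta>1 \<beta>2 c 2 = \<delta> * w"
    using meixner_a_eqs(2)[of \<beta>1 \<beta>2 c 0] by (simp add: \<delta>_def w_def flip: numeral_2_eq_2)
  have a8: "meixner_a \<beta>1 \<beta>2 c (6 * n + 8) = (\<delta> + real n + 1) * w / 2 * (B n / A (Suc n))" for n
  proof -
    define N P where "N = real (Suc n)" and "P = pochhammer N (Suc n)"
    have "N > 0"
      by (simp add: N_def)
    \<comment> \<open>Here \<open>N\<close> is both the base and the length of the symbol, so
      shifting the base by 1 multiplies it by \<open>2N / N = 2\<close>.\<close>
    moreover have "N * pochhammer (N + 1) (Suc n) = P * (N + N)"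
      unfolding P_def N_def by (rule pochhammer_add_1)
    ultimately have P': "pochhammer (N + 1) (Suc n) = 2 * P"
      by (simp add: mult_2_right)
    have P: "P > 0"
      unfolding P_def using \<open>N > 0\<close> by (rule pochhammer_pos)
    have num: "hyp2F1 (Suc n) (\<beta>2 - \<beta>1 - N) (- 2 * N + 1) (- w) = B n"
      using B_shift[of n] by (simp only: \<delta>_def N_def)
    have den: "hyp2F1 (Suc n) (\<beta>2 - \<beta>1 - N) (- 2 * N) (- w) = A (Suc n)"
      by (simp add: A_def \<delta>_def N_def)
    have "6 * Suc n + 2 = 6 * n + 8"
      by simp
    then have "meixner_a \<beta>1 \<beta>2 c (6 * n + 8) =
        P * (\<delta> + N) * c / (2 * P * (1 - c)) * (B n / A (Suc n))"
      using meixner_a_eqs(2)[of \<beta>1 \<beta>2 c "Suc n", folded N_def, unfolded z num den P', folded P_def]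
      by (simp only: \<delta>_def)
    also have "P * (\<delta> + N) * c / (2 * P * (1 - c)) = (\<delta> + N) * w / 2"
      using P c1 by (simp add: w_def field_simps)
    finally show ?thesis
      by (simp add: N_def algebra_simps)
  qed

  \<comment> \<open>Sums and products free of hypergeometric series\<close>
  have a2_a3: "meixner_a \<beta>1 \<beta>2 c (6 * k + 2) + meixner_a \<beta>1 \<beta>2 c (6 * k + 3) =
      (2 * real k + 1) * (1 + w)" for k
  proof (cases k)
    case 0
    then show ?thesis
      using a2 a3[of 0] A_0 B_0 by (simp flip: numeral_2_eq_2)
  next
    case (Suc n)
    have num: "6 * k + 2 = 6 * n + 8" "2 * real k + 1 = 2 * real n + 3"
      using Suc by simp_all
    have "meixner_a \<beta>1 \<beta>2 c (6 * k + 2) + meixner_a \<beta>1 \<beta>2 c (6 * k + 3) =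
        ((2 * real n + 3) * B (Suc n) + (\<delta> + real n + 1) * w / 2 * B n) / A (Suc n)"
      unfolding num a8 a3 by (simp only: Suc add_divide_distrib times_divide_eq_right add.commute)
    also have "\<dots> = (2 * real n + 3) * (1 + w)"
      unfolding rel2[symmetric] using A_neq_0[of "Suc n"] by simp
    finally show ?thesis
      unfolding num .
  qed
  have a5_a6: "meixner_a \<beta>1 \<beta>2 c (6 * k + 5) + meixner_a \<beta>1 \<beta>2 c (6 * k + 6) =
      2 * (real k + 1) * (1 + w)" for k
  proof -
    define N M where "N = real k + 1" and "M = 2 * real k + 1"
    have "M \<noteq> 0"
      by (simp add: M_def)
    then have "N * (N - \<delta>) * w * (1 + w) / M * (A k / B k) + 2 * N * (1 + w) * (A (Suc k) / B k) =
        2 * N * (1 + w) * (A (Suc k) + (N - \<delta>) * w / (2 * M) * A k) / B k"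
      using B_neq_0[of k] by (simp add: divide_simps) (simp add: algebra_simps)
    then show ?thesis
      using rel1[of k] B_neq_0[of k] by (simp add: a5 a6 N_def M_def)
  qed
  have a5_times_a3: "meixner_a \<beta>1 \<beta>2 c (6 * k + 5) * meixner_a \<beta>1 \<beta>2 c (6 * k + 3) =
      (real k + 1) * (real k + 1 - \<delta>) * w * (1 + w)" for k
  proof -
    have "2 * real k + 1 \<noteq> 0"
      by linarith
    then show ?thesis
      unfolding a5 a3 using A_neq_0[of k] B_neq_0[of k] by simp
  qed
  \<comment> \<open>For odd \<open>i = 2k + 1\<close> the product of the coefficients of index
    \<open>3 * i + 5\<close> and \<open>3 * i + 3\<close> joins two consecutive blocks of six, since
    \<open>6k + 8 = 6(k + 1) + 2\<close>.\<close>
  have a8_times_a6: "meixner_a \<beta>1 \<beta>2 c (6 * k + 8) * meixner_a \<beta>1 \<beta>2 c (6 * k + 6) =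
      (\<delta> + real k + 1) * (real k + 1) * w * (1 + w)" for k
    unfolding a8 a6 using A_neq_0[of "Suc k"] B_neq_0[of k] by simp (simp add: algebra_simps)

  \<comment> \<open>Comparison with the recurrence coefficients \<open>b\<close>, \<open>c\<close>
    and \<open>d\<close>\<close>
  have "meixner_b \<beta>1 \<beta>2 c 0 = meixner_a \<beta>1 \<beta>2 c 1"
    using a1[of 0] by (simp add: meixner_b_def w_def)
  moreover have "meixner_b \<beta>1 \<beta>2 c (i + 1) = meixner_a \<beta>1 \<beta>2 c (3 * i + 4) +
      meixner_a \<beta>1 \<beta>2 c (3 * i + 3) + meixner_a \<beta>1 \<beta>2 c (3 * i + 2)" for i
  \<comment> \<open>The parity of \<open>i\<close> selects the branch of the recurrence coefficient
    and also the residues modulo 6 of the indices \<open>3 * i + r\<close>.\<close>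
  proof (cases "even i")
    case True
    then obtain k where i: "i = 2 * k" ..
    have num: "3 * i + 4 = 6 * k + 4" "3 * i + 3 = 6 * k + 3" "3 * i + 2 = 6 * k + 2"
      by (simp_all add: i)
    have "meixner_b \<beta>1 \<beta>2 c (i + 1) = 2 * real k + 1 + w * (\<beta>2 + 3 * real k + 1)"
      by (simp add: i meixner_b_def Let_def w_def)
    then show ?thesis
      unfolding num a4 using a2_a3[of k] by (simp add: algebra_simps)
  next
    case False
    then obtain k where i: "i = 2 * k + 1" ..
    have num: "3 * i + 4 = 6 * Suc k + 1" "3 * i + 3 = 6 * k + 6" "3 * i + 2 = 6 * k + 5"
      by (simp_all add: i)
    have "meixner_b \<beta>1 \<beta>2 c (i + 1) = 2 * (real k + 1) + w * (\<beta>1 + 3 * (real k + 1))"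
      by (simp add: i meixner_b_def Let_def w_def)
    then show ?thesis
      unfolding num a1 of_nat_Suc using a5_a6[of k] by (simp add: algebra_simps)
  qed
  moreover have "meixner_c \<beta>1 \<beta>2 c 1 =
      (meixner_a \<beta>1 \<beta>2 c 2 + meixner_a \<beta>1 \<beta>2 c 3) * meixner_a \<beta>1 \<beta>2 c 1"
    using a2_a3[of 0] a1[of 0] cw by (simp add: meixner_c_def Let_def flip: numeral_2_eq_2)
  moreover have "meixner_c \<beta>1 \<beta>2 c (i + 2) =
      (meixner_a \<beta>1 \<beta>2 c (3 * i + 5) + meixner_a \<beta>1 \<beta>2 c (3 * i + 6)) *
        meixner_a \<beta>1 \<beta>2 c (3 * i + 4) +
      meixner_a \<beta>1 \<beta>2 c (3 * i + 5) * meixner_a \<beta>1 \<beta>2 c (3 * i + 3)" for i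
  proof (cases "even i")
    case True
    then obtain k where i: "i = 2 * k" ..
    have num: "3 * i + 5 = 6 * k + 5" "3 * i + 6 = 6 * k + 6" "3 * i + 4 = 6 * k + 4"
        "3 * i + 3 = 6 * k + 3"
      by (simp_all add: i)
    have "meixner_c \<beta>1 \<beta>2 c (i + 2) =
        w * (1 + w) * (real k + 1) * (\<beta>1 + \<beta>2 + 3 * (real k + 1) - 2)"
      by (simp add: i meixner_c_def Let_def cw)
    then show ?thesis
      unfolding num a5_a6 a5_times_a3 a4 \<delta>_def by (simp add: algebra_simps power2_eq_square)
  next
    case False
    then obtain k where i: "i = 2 * k + 1" ..
    have num: "3 * i + 5 = 6 * k + 8" "3 * i + 6 = 6 * Suc k + 3" "3 * i + 4 = 6 * Suc k + 1"
        "3 * i + 3 = 6 * k + 6"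
      by (simp_all add: i)
    \<comment> \<open>This is \<open>a2_a3\<close> in the next block, at
      \<open>Suc k\<close>.\<close>
    have a8_a9: "meixner_a \<beta>1 \<beta>2 c (6 * k + 8) + meixner_a \<beta>1 \<beta>2 c (6 * Suc k + 3) =
        (2 * (real k + 1) + 1) * (1 + w)"
      using a2_a3[of "Suc k"] by (simp add: algebra_simps)
    have "meixner_c \<beta>1 \<beta>2 c (i + 2) =
        w * (1 + w) * ((real k + 2) * \<beta>1 + (real k + 1) * (\<beta>2 + 3 * (real k + 1) + 1))"
      by (simp add: i meixner_c_def Let_def cw) (simp add: algebra_simps)
    then show ?thesis
      unfolding num a8_a9 a8_times_a6 a1 of_nat_Suc \<delta>_def by (simp add: algebra_simps power2_eq_square)
  qed
  \<comment> \<open>The first two factors form one of the products evaluated above, and the third is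
    a diagonal entry of \<open>U_mat\<close>, which contains no series.\<close>
  moreover have "meixner_d \<beta>1 \<beta>2 c (i + 2) = meixner_a \<beta>1 \<beta>2 c (3 * i + 5) *
      meixner_a \<beta>1 \<beta>2 c (3 * i + 3) * meixner_a \<beta>1 \<beta>2 c (3 * i + 1)" for i
  proof (cases "even i")
    case True
    then obtain k where i: "i = 2 * k" ..
    have num: "3 * i + 5 = 6 * k + 5" "3 * i + 1 = 6 * k + 1" "3 * i + 3 = 6 * k + 3"
      by (simp_all add: i)
    have "meixner_d \<beta>1 \<beta>2 c (i + 2) =
        w^2 * (1 + w) * (real k + 1) * (real k + 1 + \<beta>1 - 1) * (real k + 1 + \<beta>1 - \<beta>2)"
      by (simp add: i meixner_d_def Let_def cw') (simp add: algebra_simps)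
    then show ?thesis
      unfolding num a5_times_a3 a1 \<delta>_def by (simp add: algebra_simps power2_eq_square)
  next
    case False
    then obtain k where i: "i = 2 * k + 1" ..
    have num: "3 * i + 5 = 6 * k + 8" "3 * i + 1 = 6 * k + 4" "3 * i + 3 = 6 * k + 6"
      by (simp_all add: i)
    have "meixner_d \<beta>1 \<beta>2 c (i + 2) =
        w^2 * (1 + w) * (real k + 1) * (real k + 1 + \<beta>2 - 1) * (real k + 1 + \<beta>2 - \<beta>1)"
      by (simp add: i meixner_d_def Let_def cw') (simp add: algebra_simps)
    then show ?thesis
      unfolding num a8_times_a6 a4 \<delta>_def by (simp add: algebra_simps power2_eq_square)
  qed
  ultimately have factorization:
    "tetradiag_mat (meixner_b \<beta>1 \<beta>2 c) (meixner_c \<beta>1 \<beta>2 c) (meixner_d \<beta>1 \<beta>2 c) m =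
     L1_mat (meixner_a \<beta>1 \<beta>2 c) m * L2_mat (meixner_a \<beta>1 \<beta>2 c) m * U_mat (meixner_a \<beta>1 \<beta>2 c) m" for m
    by (rule tetradiag_mat_factorization)

  \<comment> \<open>Positivity of the coefficients\<close>
  have positivity: "0 < meixner_a \<beta>1 \<beta>2 c N"
    if "\<beta>1 > 0" "\<beta>2 > 0" "0 < c" "c < 1" "- 1 < \<beta>1 - \<beta>2" "\<beta>1 - \<beta>2 < 0" "N \<ge> 1" for N
  proof -
    have \<delta>: "0 < \<delta>" "\<delta> < 1" and w: "0 < w"
      using that by (simp_all add: \<delta>_def w_def)
    \<comment> \<open>For both series the condition of \<open>hyp2F1_pos\<close> on \<open>x\<close>
      amounts to \<open>\<delta> < 1\<close>. The other bound, \<open>0 < \<delta>\<close>, gives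
      the sign of the coefficient of index 2.\<close>
    have A: "0 < A n" and B: "0 < B n" for n
      unfolding A_def B_def using \<delta> w by (auto intro!: hyp2F1_pos)
    have "N = 2 \<or> (\<exists>n. N = 6 * n + 1) \<or> (\<exists>n. N = 6 * n + 3) \<or> (\<exists>n. N = 6 * n + 4) \<or>
        (\<exists>n. N = 6 * n + 5) \<or> (\<exists>n. N = 6 * n + 6) \<or> (\<exists>n. N = 6 * n + 8)"
      using \<open>N \<ge> 1\<close> by presburger
    then consider "N = 2" | n where "N = 6 * n + 1" | n where "N = 6 * n + 3"
      | n where "N = 6 * n + 4" | n where "N = 6 * n + 5" | n where "N = 6 * n + 6"
      | n where "N = 6 * n + 8"
      by blast
    then show ?thesis
    proof cases
      case 1
      then show ?thesis
        using a2 \<delta> w by simp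
    next
      case (2 n)
      then show ?thesis
        unfolding 2 a1 using that w by (intro mult_pos_pos) auto
    next
      case (3 n)
      then show ?thesis
        unfolding 3 a3 using A[of n] B[of n] by (intro mult_pos_pos divide_pos_pos) auto
    next
      case (4 n)
      then show ?thesis
        unfolding 4 a4 using that w by (intro mult_pos_pos) auto
    next
      case (5 n)
      then show ?thesis
        unfolding 5 a5 using \<delta> w A[of n] B[of n] by (intro mult_pos_pos divide_pos_pos) auto
    next
      case (6 n)
      then show ?thesis
        unfolding 6 a6 using w A[of "Suc n"] B[of n] by (intro mult_pos_pos divide_pos_pos) auto
    next
      case (7 n)
      then show ?thesis
        unfolding 7 a8 using \<delta> w A[of "Suc n"] B[of n]
        by (intro mult_pos_pos divide_pos_pos) auto
    qed
  qed
  from factorization positivity show ?thesis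
    by blast
qed

end
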